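(* Let $m\ge 1$ be an integer, let $(\mu_k)_{k\in\mathbb{N}}\subset\mathcal{P}_1^+$ and $\mu\in\mathcal{P}_1^+$ be Borel probability distributions on $\mathbb{R}^{m+1}$ such that $V_{m+1}(P(\mu))\neq 0$ and $V_{m+1}(P(\mu_k))\neq 0$ for every index $k$. If $\mu_k\to\mu$ in mean, then the sequence $G(Z(\mu_k))$ converges to $G(Z(\mu))$.
   Context: $\mathbb{R}^{m+1}_+=\{x\in\mathbb{R}^{m+1}: x\ge 0\}$, where inequalities between vectors are componentwise. $\mathcal{P}_1^+$ is the set of Borel probability measures on $\mathbb{R}^{m+1}$ with support contained in $\mathbb{R}^{m+1}_+$ and finite first moment; the mean of $\mu\in\mathcal{P}_1^+$ is the vector $m(\mu)=\int x\,d\mu(x)\in\mathbb{R}^{m+1}_+$ (componentwise integral; the function $m(\cdot)$ is unrelated to the integer $m$). A sequence $\mu_k$ converges to $\mu$ in mean if $\mu_k$ converges weakly to $\mu$ (i.e. $\int f\,d\mu_k\to\int f\,d\mu$ for every bounded continuous real function $f$) and $m(\mu_k)\to m(\mu)$. The zonoid of $\mu$ is $$Z(\mu)=\left\{\int_{\mathbb{R}^{m+1}}\phi(x)\,x\,d\mu(x)\ :\ \phi\colon\mathbb{R}^{m+1}\to[0,1]\text{ measurable}\right\},$$ a compact convex subset of $\mathbb{R}^{m+1}$. The parallelotope of $\mu$ is $P(\mu)=\{z\in\mathbb{R}^{m+1}: 0\le z\le m(\mu)\}$. $V_{m+1}$ is $(m+1)$-dimensional volume (Lebesgue measure). Note that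 $V_{m+1}(P(\mu))\ne 0$ iff $m(\mu)$ has strictly positive coordinates. When this holds, the (generalized) Gini index related to $\mu$ is $$G(Z(\mu))=\frac{V_{m+1}(Z(\mu))}{V_{m+1}(P(\mu))}.$$ *)

theory Defs
  imports "HOL-Probability.Probability"
begin

text \<open>The order \<open>\<le>\<close> on \<open>real ^ 'n\<close> is the library's componentwise order.\<close>

definition nonneg_orthant :: "(real ^ 'n) set" where
  "nonneg_orthant = {x. 0 \<le> x}"

definition measure_support :: "'a::topological_space measure \<Rightarrow> 'a set" where
  "measure_support \<mu> = {x. \<forall>U. open U \<longrightarrow> x \<in> U \<longrightarrow> emeasure \<mu> U > 0}"

definition P1plus :: "(real ^ 'n) measure set" where
  "P1plus = {\<mu>. sets \<mu> = sets borel \<and> prob_space \<mu> \<and>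
     measure_support \<mu> \<subseteq> nonneg_orthant \<and> integrable \<mu> (\<lambda>x. norm x)}"

definition mean :: "(real ^ 'n) measure \<Rightarrow> real ^ 'n" where
  "mean \<mu> = (LINT x|\<mu>. x)"

text \<open>The vector-valued Bochner integral is the componentwise integral.\<close>

lemma mean_nth:
  assumes "\<mu> \<in> P1plus"
  shows "mean \<mu> $ i = (LINT x|\<mu>. x $ i)"
proof -
  have s: "sets \<mu> = sets borel" and n: "integrable \<mu> (\<lambda>x. norm x)"
    using assms by (auto simp: P1plus_def)
  have "(\<lambda>x. x) \<in> borel_measurable \<mu>"
    by (simp add: measurable_cong_sets[OF s refl])
  with n have "integrable \<mu> (\<lambda>x. x)"
    by (simp add: integrable_norm_iff)
  then show ?thesis
    unfolding mean_def
    by (rule integral_bounded_linear[OF bounded_linear_vec_nth, symmetric])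
qed

definition weakly_converges ::
  "(nat \<Rightarrow> 'a::topological_space measure) \<Rightarrow> 'a measure \<Rightarrow> bool" where
  "weakly_converges M \<mu> \<longleftrightarrow>
     (\<forall>f :: 'a \<Rightarrow> real. continuous_on UNIV f \<longrightarrow> bounded (range f) \<longrightarrow>
        (\<lambda>k. LINT x|M k. f x) \<longlonglongrightarrow> (LINT x|\<mu>. f x))"

definition converges_in_mean ::
  "(nat \<Rightarrow> (real ^ 'n) measure) \<Rightarrow> (real ^ 'n) measure \<Rightarrow> bool" where
  "converges_in_mean M \<mu> \<longleftrightarrow>
     weakly_converges M \<mu> \<and> (\<lambda>k. mean (M k)) \<longlonglongrightarrow> mean \<mu>"

definition zonoid :: "(real ^ 'n) measure \<Rightarrow> (real ^ 'n) set" where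
  "zonoid \<mu> = {LINT x|\<mu>. \<phi> x *\<^sub>R x | \<phi> :: real ^ 'n \<Rightarrow> real.
     \<phi> \<in> borel_measurable borel \<and> range \<phi> \<subseteq> {0..1}}"

definition parallelotope :: "(real ^ 'n) measure \<Rightarrow> (real ^ 'n) set" where
  "parallelotope \<mu> = {z. 0 \<le> z \<and> z \<le> mean \<mu>}"

abbreviation volume :: "(real ^ 'n) set \<Rightarrow> real" where
  "volume S \<equiv> measure lebesgue S"

text \<open>The Gini index written \<open>G(Z(\<mu>))\<close>; its denominator depends on \<open>\<mu>\<close>, so it is
  taken as a function of \<open>\<mu>\<close>. It is meaningful only if the parallelotope has nonzero volume.\<close>

definition gini_index :: "(real ^ 'n) measure \<Rightarrow> real" where
  "gini_index \<mu> = volume (zonoid \<mu>) / volume (parallelotope \<mu>)"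

end

theory Submission
  imports Defs
begin

text \<open>A convex body is determined by its support function \<open>u \<mapsto> sup {u \<bullet> z | z \<in> K}\<close>, and
  the support function of a zonoid is an integral:
  \<open>sup {u \<bullet> z | z \<in> Z(\<mu>)} = \<integral> max (u \<bullet> x) 0 d\<mu>(x)\<close>, because the best choice of \<open>\<phi>\<close> keeps
  exactly the half-space where \<open>u \<bullet> x\<close> is positive (\<open>support_function_zonoid\<close>). The integrand
  is continuous but unbounded, so weak convergence alone does not pass to the limit; it is dominated
  by a multiple of the \<open>\<ell>\<^sup>1\<close> norm, whose integral on the positive orthant is the sum of the
  coordinates of the mean. Convergence of the means therefore rules out escape of mass to infinity,
  and a generalized dominated convergence argument (\<open>integral_tendsto_of_dominated\<close>) gives
  pointwise convergence of the support functions of the zonoids.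

  It remains to pass from support functions to volumes
  (\<open>volume_tendsto_of_support_function_tendsto\<close>). For uniformly bounded convex sets, pointwise
  convergence of support functions forces every interior point of the limit to lie eventually in the
  approximating sets, and every point off its closure to lie eventually outside them. So the
  indicator functions converge off the frontier of the limit, which is negligible by convexity, and
  dominated convergence applies. The denominator of the Gini index is the volume of a box, the
  product of the coordinates of the mean.\<close>

section \<open>Volumes of convex sets with converging support functions\<close>

text \<open>If \<open>x\<close> is at depth \<open>r\<close> inside \<open>L\<close>, the support function of \<open>L\<close> in every unit direction
  exceeds \<open>u \<bullet> x\<close> by at least \<open>r\<close>, whereas a point missed by \<open>K n\<close> admits a unit direction in
  which the support function of \<open>K n\<close> is at most \<open>u \<bullet> x\<close>. That direction depends on \<open>n\<close>, so
  pointwise convergence is used on a finite net of the sphere; the common bound \<open>R\<close> makes the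
  support functions equi-Lipschitz and so controls the error of moving to the net.\<close>

lemma eventually_mem_of_mem_interior:
  fixes K :: "nat \<Rightarrow> 'a::euclidean_space set"
  assumes K: "\<And>n. convex (K n)" "\<And>n. K n \<noteq> {}" "\<And>n. K n \<subseteq> cball 0 R"
    and L: "bounded L"
    and supp: "\<And>u. (\<lambda>n. SUP z\<in>K n. u \<bullet> z) \<longlonglongrightarrow> (SUP z\<in>L. u \<bullet> z)"
    and x: "x \<in> interior L"
  shows "\<forall>\<^sub>F n in sequentially. x \<in> K n"
proof -
  obtain r where r: "r > 0" "cball x r \<subseteq> L"
    using x mem_interior_cball by blast
  obtain y where "y \<in> K 0" using K(2) by blast
  then have "norm y \<le> R" using K(3)[of 0] by auto
  then have R: "R \<ge> 0" using norm_ge_zero order_trans by blast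
  \<comment> \<open>The mesh is chosen so that moving to the net, which costs at most \<open>\<delta> * (norm x + R)\<close>,
    uses up no more than half of the gap \<open>r\<close>; the summand 1 avoids division by zero.\<close>
  define \<delta> where "\<delta> = r / (2 * (R + norm x + 1))"
  have pos: "R + norm x + 1 > 0" using R by (simp add: add_nonneg_pos)
  have \<delta>: "\<delta> > 0" using r pos by (simp add: \<delta>_def)
  have "\<delta> * (norm x + R) \<le> \<delta> * (R + norm x + 1)" using \<delta> by (intro mult_left_mono) auto
  also have "\<dots> = r / 2" using pos by (simp add: \<delta>_def field_simps)
  finally have \<delta>r: "\<delta> * (norm x + R) \<le> r / 2" .
  obtain N where N: "N \<subseteq> sphere (0::'a) 1" "finite N" "sphere (0::'a) 1 \<subseteq> (\<Union>v\<in>N. ball v \<delta>)"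
  proof (rule compactE_image[of "sphere (0::'a) 1" "sphere (0::'a) 1" "\<lambda>v. ball v \<delta>"])
    show "sphere (0::'a) 1 \<subseteq> (\<Union>v\<in>sphere 0 1. ball v \<delta>)"
    proof
      fix v :: 'a assume "v \<in> sphere 0 1"
      moreover have "v \<in> ball v \<delta>" using \<delta> by (rule centre_in_ball[THEN iffD2])
      ultimately show "v \<in> (\<Union>v\<in>sphere 0 1. ball v \<delta>)" by (rule UN_I)
    qed
  qed simp_all
  have bdd: "bdd_above ((\<bullet>) u ` L)" for u
    by (rule bounded_imp_bdd_above, rule bounded_linear_image[OF L]) (rule bounded_linear_inner_right)
  have gap: "u \<bullet> x + r / 2 < (SUP z\<in>L. u \<bullet> z)" if "u \<in> N" for u
  proof -
    have n1: "norm u = 1" using N(1) that by auto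
    have "x + r *\<^sub>R u \<in> L" using r n1 by (intro subsetD[OF r(2)]) (auto simp: dist_norm)
    then have "u \<bullet> (x + r *\<^sub>R u) \<le> (SUP z\<in>L. u \<bullet> z)"
      by (intro cSUP_upper bdd)
    moreover have "u \<bullet> u = 1" using n1 by (simp add: dot_square_norm)
    ultimately show ?thesis using r by (simp add: inner_add_right)
  qed
  have "\<forall>\<^sub>F n in sequentially. \<forall>u\<in>N. u \<bullet> x + r / 2 < (SUP z\<in>K n. u \<bullet> z)"
    by (rule eventually_ball_finite[OF N(2)]) (use supp gap order_tendstoD(1) in blast)
  then show ?thesis
  proof eventually_elim
    fix n assume n: "\<forall>u\<in>N. u \<bullet> x + r / 2 < (SUP z\<in>K n. u \<bullet> z)"
    show "x \<in> K n"
    proof (rule ccontr)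
      assume "x \<notin> K n"
      then obtain a b where ab: "a \<noteq> 0" "\<forall>y\<in>K n. a \<bullet> y \<le> b" "\<forall>y\<in>{x}. a \<bullet> y \<ge> b"
        using separating_hyperplane_sets[OF K(1)[of n] convex_singleton K(2), of x] by auto
      define u where "u = a /\<^sub>R norm a"
      have u: "u \<bullet> y \<le> u \<bullet> x" if "y \<in> K n" for y
      proof -
        have "a \<bullet> y \<le> a \<bullet> x" using ab that by force
        then show ?thesis unfolding u_def inner_scaleR_left by (rule mult_left_mono) auto
      qed
      have "u \<in> sphere 0 1" using ab(1) by (simp add: u_def)
      then obtain v where v: "v \<in> N" "norm (v - u) < \<delta>" using N(3) by (auto simp: dist_norm)
      have "v \<bullet> y \<le> v \<bullet> x + r / 2" if y: "y \<in> K n" for y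
      proof -
        have "(v - u) \<bullet> (y - x) \<le> norm (v - u) * norm (y - x)" by (rule norm_cauchy_schwarz)
        also have "\<dots> \<le> \<delta> * (norm x + R)"
          using v(2) \<delta> y K(3)[of n] norm_triangle_ineq4[of y x]
          by (intro mult_mono) (auto simp: subset_iff)
        finally have "(v - u) \<bullet> (y - x) \<le> r / 2" using \<delta>r by linarith
        then show ?thesis using u[OF y] by (simp add: inner_diff_left inner_diff_right)
      qed
      then have "(SUP z\<in>K n. v \<bullet> z) \<le> v \<bullet> x + r / 2" by (intro cSUP_least K(2))
      then show False using n v(1) by force
    qed
  qed
qed

text \<open>A direction that strictly separates \<open>x\<close> from the closure of \<open>L\<close> depends on \<open>L\<close> alone, so
  convergence of the support functions in that one direction excludes \<open>x\<close> from \<open>K n\<close> for large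
  \<open>n\<close>.\<close>

lemma eventually_not_mem_of_not_mem_closure:
  fixes K :: "nat \<Rightarrow> 'a::euclidean_space set"
  assumes K: "\<And>n. bounded (K n)"
    and L: "convex L" "L \<noteq> {}"
    and supp: "\<And>u. (\<lambda>n. SUP z\<in>K n. u \<bullet> z) \<longlonglongrightarrow> (SUP z\<in>L. u \<bullet> z)"
    and x: "x \<notin> closure L"
  shows "\<forall>\<^sub>F n in sequentially. x \<notin> K n"
proof -
  obtain a b where ab: "a \<bullet> x < b" "\<forall>z\<in>closure L. b < a \<bullet> z"
    using separating_hyperplane_closed_point[OF convex_closure[OF L(1)] closed_closure x] by blast
  \<comment> \<open>The separation theorem puts \<open>L\<close> on the upper side, so the support function is taken at
    \<open>- a\<close>.\<close>
  have "(SUP z\<in>L. (-a) \<bullet> z) \<le> - b"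
    using ab(2) closure_subset[of L] by (intro cSUP_least L(2)) (auto simp: less_imp_le)
  also have "\<dots> < (-a) \<bullet> x" using ab(1) by simp
  finally have "\<forall>\<^sub>F n in sequentially. (SUP z\<in>K n. (-a) \<bullet> z) < (-a) \<bullet> x"
    by (rule order_tendstoD(2)[OF supp])
  then show ?thesis
  proof eventually_elim
    fix n assume n: "(SUP z\<in>K n. (-a) \<bullet> z) < (-a) \<bullet> x"
    have bdd: "bdd_above ((\<bullet>) (-a) ` K n)"
      by (rule bounded_imp_bdd_above, rule bounded_linear_image[OF K]) (rule bounded_linear_inner_right)
    show "x \<notin> K n" using cSUP_upper[OF _ bdd, of x] n by auto
  qed
qed

text \<open>The two preceding lemmas decide membership for all points off the frontier of \<open>L\<close>, a null
  set, so the indicator functions converge almost everywhere, dominated by that of the ball.\<close>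

theorem volume_tendsto_of_support_function_tendsto:
  fixes K :: "nat \<Rightarrow> 'a::euclidean_space set"
  assumes K: "\<And>n. convex (K n)" "\<And>n. K n \<noteq> {}" "\<And>n. K n \<subseteq> cball 0 R"
    and L: "convex L" "L \<noteq> {}" "bounded L"
    and supp: "\<And>u. (\<lambda>n. SUP z\<in>K n. u \<bullet> z) \<longlonglongrightarrow> (SUP z\<in>L. u \<bullet> z)"
  shows "(\<lambda>n. measure lebesgue (K n)) \<longlonglongrightarrow> measure lebesgue L"
proof -
  have bK: "bounded (K n)" for n using K(3) bounded_cball bounded_subset by blast
  have meas: "K n \<in> lmeasurable" "L \<in> lmeasurable" for n
    using measurable_convex K(1) bK L by blast+
  have "(\<lambda>n. LINT x|lebesgue. indicat_real (K n) x) \<longlonglongrightarrow> (LINT x|lebesgue. indicat_real L x)"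
  proof (rule integral_dominated_convergence[where w = "indicat_real (cball 0 R)"])
    have "AE x in lebesgue. x \<notin> frontier L"
      using negligible_convex_frontier[OF L(1)] by (intro AE_not_in) (simp add: negligible_iff_null_sets)
    then show "AE x in lebesgue. (\<lambda>n. indicat_real (K n) x) \<longlonglongrightarrow> indicat_real L x"
    proof eventually_elim
      fix x assume "x \<notin> frontier L"
      then consider "x \<in> interior L" | "x \<notin> closure L" by (auto simp: frontier_def)
      then have "\<forall>\<^sub>F n in sequentially. indicat_real (K n) x = indicat_real L x"
      proof cases
        case 1
        then have "x \<in> L" using interior_subset by blast
        show ?thesis using eventually_mem_of_mem_interior[OF K L(3) supp 1]
          by eventually_elim (simp add: \<open>x \<in> L\<close>)
      next
        case 2
        then have "x \<notin> L" using closure_subset by blast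
        show ?thesis using eventually_not_mem_of_not_mem_closure[OF bK L(1,2) supp 2]
          by eventually_elim (simp add: \<open>x \<notin> L\<close>)
      qed
      then show "(\<lambda>n. indicat_real (K n) x) \<longlonglongrightarrow> indicat_real L x"
        by (rule tendsto_eventually)
    qed
    show "indicat_real L \<in> borel_measurable lebesgue"
      "indicat_real (K n) \<in> borel_measurable lebesgue" for n
      using meas by (auto intro!: borel_measurable_indicator dest: fmeasurableD)
    show "integrable lebesgue (indicat_real (cball 0 R))"
      using lmeasurable_cball by (intro integrable_real_indicator) (auto simp: fmeasurable_def)
    show "AE x in lebesgue. norm (indicat_real (K n) x) \<le> indicat_real (cball 0 R) x" for n
      using K(3)[of n] by (intro AE_I2) (auto simp: indicator_def)
  qed
  then show ?thesis using meas by (simp add: fmeasurable_def)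
qed

section \<open>Weak convergence and unbounded integrands\<close>

text \<open>In a weak limit, part of the integral of \<open>f\<close> may escape to infinity, but none can appear:
  truncating \<open>f\<close> at a height
  \<open>N\<close> that loses little under \<open>\<mu>\<close> gives a bounded continuous minorant.\<close>

lemma integral_lower_semicontinuous:
  fixes f :: "'a::topological_space \<Rightarrow> real"
  assumes w: "weakly_converges M \<mu>"
    and f: "continuous_on UNIV f" "\<And>x. f x \<ge> 0"
    and int: "\<And>k. integrable (M k) f" "integrable \<mu> f"
    and c: "c < (LINT x|\<mu>. f x)"
  shows "\<forall>\<^sub>F k in sequentially. c < (LINT x|M k. f x)"
proof -
  have "(\<lambda>N. LINT x|\<mu>. min (f x) (real N)) \<longlonglongrightarrow> (LINT x|\<mu>. f x)"
  proof (rule integral_dominated_convergence[where w = f])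
    show "AE x in \<mu>. (\<lambda>N. min (f x) (real N)) \<longlonglongrightarrow> f x"
    proof (rule AE_I2)
      fix x
      obtain N0 where "f x \<le> real N0" using real_arch_simple by blast
      then have "\<forall>\<^sub>F N in sequentially. min (f x) (real N) = f x"
        by (auto simp: eventually_sequentially intro!: exI[of _ N0])
      then show "(\<lambda>N. min (f x) (real N)) \<longlonglongrightarrow> f x" by (rule tendsto_eventually)
    qed
  qed (use int f(2) in \<open>auto intro!: borel_measurable_min\<close>)
  then have "\<forall>\<^sub>F N in sequentially. c < (LINT x|\<mu>. min (f x) (real N))"
    using c order_tendstoD(1) by blast
  then obtain N where N: "c < (LINT x|\<mu>. min (f x) (real N))"
    using eventually_happens sequentially_bot by blast
  have bdd: "bounded (range (\<lambda>x. min (f x) (real N)))"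
    by (rule boundedI[of _ "real N"]) (use f(2) in \<open>auto simp: min_def\<close>)
  have "(\<lambda>k. LINT x|M k. min (f x) (real N)) \<longlonglongrightarrow> (LINT x|\<mu>. min (f x) (real N))"
    using w bdd f(1) unfolding weakly_converges_def by (auto intro!: continuous_intros)
  from order_tendstoD(1)[OF this N] show ?thesis
  proof eventually_elim
    fix k assume k: "c < (LINT x|M k. min (f x) (real N))"
    have "(LINT x|M k. min (f x) (real N)) \<le> (LINT x|M k. f x)"
    proof (rule integral_mono[OF _ int(1)])
      have "(\<lambda>x. min (f x) (real N)) \<in> borel_measurable (M k)"
        by (intro borel_measurable_min borel_measurable_const borel_measurable_integrable[OF int(1)])
      moreover have "norm (min (f x) (real N)) \<le> norm (f x)" for x
        using f(2)[of x] by (simp add: min_def)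
      ultimately show "integrable (M k) (\<lambda>x. min (f x) (real N))"
        by (intro Bochner_Integration.integrable_bound[OF int(1)[of k]] AE_I2)
    qed simp
    with k show "c < (LINT x|M k. f x)" by linarith
  qed
qed

text \<open>Lower semicontinuity is applied to the nonnegative functions \<open>s + g\<close> and \<open>s - g\<close>. As the
  integrals of \<open>s\<close> converge, the first bounds the integrals of \<open>g\<close> from below in the limit and the
  second from above.\<close>

lemma integral_tendsto_of_dominated:
  fixes g s :: "'a::topological_space \<Rightarrow> real"
  assumes w: "weakly_converges M \<mu>"
    and M: "\<And>k. sets (M k) = sets borel" and \<mu>: "sets \<mu> = sets borel"
    and cont: "continuous_on UNIV g" "continuous_on UNIV s"
    and dom: "\<And>x. \<bar>g x\<bar> \<le> s x"
    and int: "\<And>k. integrable (M k) s" "integrable \<mu> s"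
    and lim: "(\<lambda>k. LINT x|M k. s x) \<longlonglongrightarrow> (LINT x|\<mu>. s x)"
  shows "(\<lambda>k. LINT x|M k. g x) \<longlonglongrightarrow> (LINT x|\<mu>. g x)"
proof -
  have gb: "g \<in> borel_measurable borel" using cont borel_measurable_continuous_onI by blast
  have ig: "integrable (M k) g" "integrable \<mu> g" for k
  proof -
    have "norm (g x) \<le> norm (s x)" for x using dom[of x] by simp
    moreover have "g \<in> borel_measurable (M k)" "g \<in> borel_measurable \<mu>"
      using gb by (simp_all add: measurable_cong_sets[OF M refl] measurable_cong_sets[OF \<mu> refl])
    ultimately show "integrable (M k) g" "integrable \<mu> g"
      using int by (blast intro: Bochner_Integration.integrable_bound AE_I2)+
  qed
  have nonneg: "s x + g x \<ge> 0" "s x - g x \<ge> 0" for x using dom[of x] by linarith+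
  show ?thesis
  proof (rule tendstoI)
    fix e :: real assume e: "e > 0"
    have up: "\<forall>\<^sub>F k in sequentially. (LINT x|\<mu>. s x + g x) - e / 2 < (LINT x|M k. s x + g x)"
      using e by (intro integral_lower_semicontinuous[OF w] continuous_intros cont nonneg
          Bochner_Integration.integrable_add Bochner_Integration.integrable_diff ig int) simp
    have lo: "\<forall>\<^sub>F k in sequentially. (LINT x|\<mu>. s x - g x) - e / 2 < (LINT x|M k. s x - g x)"
      using e by (intro integral_lower_semicontinuous[OF w] continuous_intros cont nonneg
          Bochner_Integration.integrable_add Bochner_Integration.integrable_diff ig int) simp
    have "\<forall>\<^sub>F k in sequentially. dist (LINT x|M k. s x) (LINT x|\<mu>. s x) < e / 2"
      using lim e by (intro tendstoD) auto
    with up lo show "\<forall>\<^sub>F k in sequentially. dist (LINT x|M k. g x) (LINT x|\<mu>. g x) < e"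
    proof eventually_elim
      case (elim k)
      then show ?case
        unfolding Bochner_Integration.integral_add[OF int(1) ig(1)]
          Bochner_Integration.integral_add[OF int(2) ig(2)]
          Bochner_Integration.integral_diff[OF int(1) ig(1)]
          Bochner_Integration.integral_diff[OF int(2) ig(2)]
          dist_real_def
        by linarith
    qed
  qed
qed

section \<open>Measures supported on the positive orthant\<close>

text \<open>The complement of the support is a union of open null sets, a priori an uncountable one; the
  Lindelof property reduces it to a countable union.\<close>

lemma compl_measure_support_null:
  fixes \<mu> :: "'a::second_countable_topology measure"
  assumes \<mu>: "sets \<mu> = sets borel"
  shows "- measure_support \<mu> \<in> null_sets \<mu>"
proof -
  obtain F where F: "F \<subseteq> {U. open U \<and> emeasure \<mu> U = 0}" "countable F"
    "\<Union>F = \<Union>{U. open U \<and> emeasure \<mu> U = 0}"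
    using Lindelof[of "{U. open U \<and> emeasure \<mu> U = 0}"] by blast
  have "\<Union>F \<in> null_sets \<mu>"
    using null_sets_UN'[OF F(2), of id \<mu>] F(1) \<mu> by (fastforce simp: null_sets_def)
  moreover have "- measure_support \<mu> = \<Union>F"
    unfolding F(3) by (auto simp: measure_support_def zero_less_iff_neq_zero)
  ultimately show ?thesis by simp
qed

lemma P1plusD:
  fixes \<mu> :: "(real ^ 'n) measure"
  assumes "\<mu> \<in> P1plus"
  shows "sets \<mu> = sets borel" "integrable \<mu> (\<lambda>x. x)" "AE x in \<mu>. 0 \<le> x"
proof -
  show s: "sets \<mu> = sets borel" using assms by (simp add: P1plus_def)
  have "(\<lambda>x. x) \<in> borel_measurable \<mu>"
    by (simp add: measurable_cong_sets[OF s refl])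
  then show "integrable \<mu> (\<lambda>x. x)"
    using assms by (simp add: integrable_norm_iff P1plus_def)
  show "AE x in \<mu>. 0 \<le> x"
    using AE_not_in[OF compl_measure_support_null[OF s]]
    by eventually_elim (use assms in \<open>auto simp: P1plus_def nonneg_orthant_def\<close>)
qed

lemma integrable_nth:
  fixes \<mu> :: "(real ^ 'n) measure"
  assumes "\<mu> \<in> P1plus"
  shows "integrable \<mu> (\<lambda>x. x $ i)"
  by (rule integrable_bounded_linear[OF bounded_linear_vec_nth P1plusD(2)[OF assms]])

text \<open>This turns convergence of the means, a statement about vectors, into convergence of the
  integrals of a function that dominates the norm.\<close>

lemma integral_l1_norm_eq_sum_mean:
  fixes \<mu> :: "(real ^ 'n) measure"
  assumes "\<mu> \<in> P1plus"
  shows "(LINT x|\<mu>. (\<Sum>i\<in>UNIV. \<bar>x $ i\<bar>)) = (\<Sum>i\<in>UNIV. mean \<mu> $ i)"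
proof -
  have "(LINT x|\<mu>. (\<Sum>i\<in>UNIV. \<bar>x $ i\<bar>)) = (\<Sum>i\<in>UNIV. LINT x|\<mu>. \<bar>x $ i\<bar>)"
    by (intro Bochner_Integration.integral_sum integrable_abs integrable_nth assms)
  moreover have "(LINT x|\<mu>. \<bar>x $ i\<bar>) = mean \<mu> $ i" for i
    unfolding mean_nth[OF assms]
  proof (rule integral_cong_AE)
    show "AE x in \<mu>. \<bar>x $ i\<bar> = x $ i"
      using P1plusD(3)[OF assms] by eventually_elim (simp add: less_eq_vec_def)
  qed (use borel_measurable_integrable[OF integrable_nth[OF assms]] in auto)
  ultimately show ?thesis by simp
qed

section \<open>The zonoid and its support function\<close>

lemma integrable_scaleR_test_function:
  fixes \<mu> :: "(real ^ 'n) measure"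
  assumes "\<mu> \<in> P1plus" and \<phi>: "\<phi> \<in> borel_measurable borel" "range \<phi> \<subseteq> {0..1}"
  shows "integrable \<mu> (\<lambda>x. \<phi> x *\<^sub>R x)"
proof (rule Bochner_Integration.integrable_bound[OF P1plusD(2)[OF assms(1)]])
  show "(\<lambda>x. \<phi> x *\<^sub>R x) \<in> borel_measurable \<mu>"
    unfolding measurable_cong_sets[OF P1plusD(1)[OF assms(1)] refl] using \<phi>(1) by measurable
  have "\<bar>\<phi> x\<bar> \<le> 1" for x using \<phi>(2) by (auto simp: image_subset_iff)
  then show "AE x in \<mu>. norm (\<phi> x *\<^sub>R x) \<le> norm x"
    by (intro AE_I2) (simp add: mult_left_le_one_le)
qed

lemma zonoid_nonempty: "zonoid \<mu> \<noteq> {}"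
proof -
  have "(LINT x|\<mu>. (\<lambda>_. 0) x *\<^sub>R x) \<in> zonoid \<mu>"
    unfolding zonoid_def by (intro CollectI exI[of _ "\<lambda>_. 0"]) auto
  then show ?thesis by blast
qed

lemma convex_zonoid:
  fixes \<mu> :: "(real ^ 'n) measure"
  assumes "\<mu> \<in> P1plus"
  shows "convex (zonoid \<mu>)"
proof (rule convexI)
  fix y z and u v :: real
  assume "y \<in> zonoid \<mu>" "z \<in> zonoid \<mu>" and uv: "0 \<le> u" "0 \<le> v" "u + v = 1"
  then obtain \<phi> \<psi> where
    \<phi>: "\<phi> \<in> borel_measurable borel" "range \<phi> \<subseteq> {0..1}" "y = (LINT x|\<mu>. \<phi> x *\<^sub>R x)" and
    \<psi>: "\<psi> \<in> borel_measurable borel" "range \<psi> \<subseteq> {0..1}" "z = (LINT x|\<mu>. \<psi> x *\<^sub>R x)"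
    unfolding zonoid_def by blast
  let ?\<chi> = "\<lambda>x. u * \<phi> x + v * \<psi> x"
  have "u *\<^sub>R y + v *\<^sub>R z = (LINT x|\<mu>. ?\<chi> x *\<^sub>R x)"
    using integrable_scaleR_test_function[OF assms \<phi>(1,2)]
      integrable_scaleR_test_function[OF assms \<psi>(1,2)]
    by (simp add: \<phi>(3) \<psi>(3) scaleR_add_left flip: scaleR_scaleR)
  moreover have "?\<chi> \<in> borel_measurable borel" using \<phi>(1) \<psi>(1) by measurable
  moreover have "range ?\<chi> \<subseteq> {0..1}"
  proof (clarsimp simp: image_subset_iff, intro conjI)
    fix x
    have *: "0 \<le> \<phi> x" "\<phi> x \<le> 1" "0 \<le> \<psi> x" "\<psi> x \<le> 1" using \<phi>(2) \<psi>(2) by (auto simp: image_subset_iff)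
    then show "0 \<le> ?\<chi> x" using uv by simp
    show "?\<chi> x \<le> 1" using * uv by (intro convex_bound_le)
  qed
  ultimately show "u *\<^sub>R y + v *\<^sub>R z \<in> zonoid \<mu>"
    unfolding zonoid_def by (intro CollectI exI[of _ ?\<chi>] conjI)
qed

lemma zonoid_subset_cball:
  fixes \<mu> :: "(real ^ 'n) measure"
  assumes "\<mu> \<in> P1plus"
  shows "zonoid \<mu> \<subseteq> cball 0 (\<Sum>i\<in>UNIV. mean \<mu> $ i)"
proof
  fix z assume "z \<in> zonoid \<mu>"
  then obtain \<phi> where \<phi>: "\<phi> \<in> borel_measurable borel" "range \<phi> \<subseteq> {0..1}" "z = (LINT x|\<mu>. \<phi> x *\<^sub>R x)"
    unfolding zonoid_def by blast
  have "norm z \<le> (LINT x|\<mu>. norm (\<phi> x *\<^sub>R x))" unfolding \<phi>(3) by (rule integral_norm_bound)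
  also have "\<dots> \<le> (LINT x|\<mu>. (\<Sum>i\<in>UNIV. \<bar>x $ i\<bar>))"
  proof (rule integral_mono)
    show "integrable \<mu> (\<lambda>x. norm (\<phi> x *\<^sub>R x))"
      by (rule integrable_norm[OF integrable_scaleR_test_function[OF assms \<phi>(1,2)]])
    show "integrable \<mu> (\<lambda>x. \<Sum>i\<in>UNIV. \<bar>x $ i\<bar>)"
      by (intro Bochner_Integration.integrable_sum integrable_abs integrable_nth assms)
    fix x
    have "\<bar>\<phi> x\<bar> \<le> 1" using \<phi>(2) by (auto simp: image_subset_iff)
    then have "norm (\<phi> x *\<^sub>R x) \<le> norm x" by (simp add: mult_left_le_one_le)
    then show "norm (\<phi> x *\<^sub>R x) \<le> (\<Sum>i\<in>UNIV. \<bar>x $ i\<bar>)"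
      using norm_le_l1_cart[of x] by linarith
  qed
  finally show "z \<in> cball 0 (\<Sum>i\<in>UNIV. mean \<mu> $ i)"
    by (simp add: integral_l1_norm_eq_sum_mean[OF assms])
qed

text \<open>Since \<open>\<phi> x * (u \<bullet> x) \<le> max (u \<bullet> x) 0\<close> whenever \<open>0 \<le> \<phi> x \<le> 1\<close>, with equality for the
  indicator function of the half-space \<open>u \<bullet> x > 0\<close>, the supremum is attained.\<close>

lemma support_function_zonoid:
  fixes \<mu> :: "(real ^ 'n) measure"
  assumes "\<mu> \<in> P1plus"
  shows "(SUP z\<in>zonoid \<mu>. u \<bullet> z) = (LINT x|\<mu>. max (u \<bullet> x) 0)"
proof -
  have eq: "u \<bullet> (LINT x|\<mu>. \<phi> x *\<^sub>R x) = (LINT x|\<mu>. \<phi> x * (u \<bullet> x))"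
    "integrable \<mu> (\<lambda>x. \<phi> x * (u \<bullet> x))"
    if "\<phi> \<in> borel_measurable borel" "range \<phi> \<subseteq> {0..1}" for \<phi>
    using integrable_scaleR_test_function[OF assms that]
      integral_inner_right[of u \<mu> "\<lambda>x. \<phi> x *\<^sub>R x"] integrable_inner_right[of u \<mu> "\<lambda>x. \<phi> x *\<^sub>R x"]
    by auto
  let ?\<phi> = "indicat_real {x. 0 < u \<bullet> x}"
  have \<phi>: "?\<phi> \<in> borel_measurable borel" "range ?\<phi> \<subseteq> {0..1}"
    by (auto simp: indicator_def intro!: borel_measurable_indicator)
  have max_eq: "?\<phi> x * (u \<bullet> x) = max (u \<bullet> x) 0" for x by (auto simp: indicator_def)
  have int: "integrable \<mu> (\<lambda>x. max (u \<bullet> x) 0)" using eq(2)[OF \<phi>] by (simp add: max_eq)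
  show ?thesis
  proof (rule cSup_eq_maximum)
    show "(LINT x|\<mu>. max (u \<bullet> x) 0) \<in> (\<bullet>) u ` zonoid \<mu>"
    proof (rule image_eqI)
      show "(LINT x|\<mu>. max (u \<bullet> x) 0) = u \<bullet> (LINT x|\<mu>. ?\<phi> x *\<^sub>R x)"
        by (simp add: eq(1)[OF \<phi>] max_eq)
      show "(LINT x|\<mu>. ?\<phi> x *\<^sub>R x) \<in> zonoid \<mu>" unfolding zonoid_def using \<phi> by blast
    qed
    fix t assume "t \<in> (\<bullet>) u ` zonoid \<mu>"
    then obtain \<psi> where \<psi>: "\<psi> \<in> borel_measurable borel" "range \<psi> \<subseteq> {0..1}"
      "t = u \<bullet> (LINT x|\<mu>. \<psi> x *\<^sub>R x)" unfolding zonoid_def by blast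
    show "t \<le> (LINT x|\<mu>. max (u \<bullet> x) 0)"
      unfolding \<psi>(3) eq(1)[OF \<psi>(1,2)]
    proof (rule integral_mono[OF eq(2)[OF \<psi>(1,2)] int])
      fix x
      have "0 \<le> \<psi> x" "\<psi> x \<le> 1" using \<psi>(2) by (auto simp: image_subset_iff)
      then have "\<psi> x * (u \<bullet> x) \<le> \<psi> x * max (u \<bullet> x) 0" "\<psi> x * max (u \<bullet> x) 0 \<le> max (u \<bullet> x) 0"
        by (intro mult_left_mono mult_left_le_one_le; simp)+
      then show "\<psi> x * (u \<bullet> x) \<le> max (u \<bullet> x) 0" by linarith
    qed
  qed
qed

section \<open>Convergence in mean and the Gini index\<close>

lemma support_function_zonoid_tendsto:
  fixes M :: "nat \<Rightarrow> (real ^ 'n) measure"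
  assumes M: "\<And>k. M k \<in> P1plus" and \<mu>: "\<mu> \<in> P1plus" and conv: "converges_in_mean M \<mu>"
  shows "(\<lambda>k. SUP z\<in>zonoid (M k). u \<bullet> z) \<longlonglongrightarrow> (SUP z\<in>zonoid \<mu>. u \<bullet> z)"
proof -
  have w: "weakly_converges M \<mu>" and mean: "(\<lambda>k. mean (M k)) \<longlonglongrightarrow> mean \<mu>"
    using conv by (auto simp: converges_in_mean_def)
  let ?s = "\<lambda>x::real^'n. norm u * (\<Sum>i\<in>UNIV. \<bar>x $ i\<bar>)"
  have int: "integrable \<nu> ?s" if "\<nu> \<in> P1plus" for \<nu> :: "(real ^ 'n) measure"
    by (intro integrable_mult_right Bochner_Integration.integrable_sum integrable_abs integrable_nth that)
  have "(\<lambda>k. LINT x|M k. ?s x) \<longlonglongrightarrow> (LINT x|\<mu>. ?s x)"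
    unfolding Bochner_Integration.integral_mult_right_zero integral_l1_norm_eq_sum_mean[OF M]
      integral_l1_norm_eq_sum_mean[OF \<mu>]
    by (intro tendsto_intros mean)
  moreover have "\<bar>max (u \<bullet> x) 0\<bar> \<le> ?s x" for x
  proof -
    have "\<bar>max (u \<bullet> x) 0\<bar> \<le> \<bar>u \<bullet> x\<bar>" by (simp add: max_def)
    also have "\<dots> \<le> norm u * norm x" by (rule Cauchy_Schwarz_ineq2)
    also have "\<dots> \<le> ?s x" by (intro mult_left_mono norm_le_l1_cart) simp
    finally show ?thesis .
  qed
  moreover have "continuous_on UNIV (\<lambda>x. max (u \<bullet> x) 0)" "continuous_on UNIV ?s"
    by (intro continuous_intros)+
  ultimately show ?thesis
    unfolding support_function_zonoid[OF M] support_function_zonoid[OF \<mu>]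
    using integral_tendsto_of_dominated[OF w P1plusD(1)[OF M] P1plusD(1)[OF \<mu>]
        _ _ _ int[OF M] int[OF \<mu>], where g = "\<lambda>x. max (u \<bullet> x) 0"]
    by blast
qed

lemma volume_zonoid_tendsto:
  fixes M :: "nat \<Rightarrow> (real ^ 'n) measure"
  assumes M: "\<And>k. M k \<in> P1plus" and \<mu>: "\<mu> \<in> P1plus" and conv: "converges_in_mean M \<mu>"
  shows "(\<lambda>k. volume (zonoid (M k))) \<longlonglongrightarrow> volume (zonoid \<mu>)"
proof -
  have "(\<lambda>k. \<Sum>i\<in>UNIV. mean (M k) $ i) \<longlonglongrightarrow> (\<Sum>i\<in>UNIV. mean \<mu> $ i)"
    using conv unfolding converges_in_mean_def by (intro tendsto_intros) auto
  then have "Bseq (\<lambda>k. \<Sum>i\<in>UNIV. mean (M k) $ i)" by (rule convergent_imp_Bseq[OF convergentI])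
  then obtain R where "\<And>k. \<bar>\<Sum>i\<in>UNIV. mean (M k) $ i\<bar> \<le> R" by (auto simp: Bseq_def)
  then have "zonoid (M k) \<subseteq> cball 0 R" for k
    using zonoid_subset_cball[OF M, of k] subset_cball[of "\<Sum>i\<in>UNIV. mean (M k) $ i" R 0]
    by (meson abs_le_D1 order_trans)
  moreover have "bounded (zonoid \<mu>)"
    using zonoid_subset_cball[OF \<mu>] bounded_cball bounded_subset by blast
  ultimately show ?thesis
    by (intro volume_tendsto_of_support_function_tendsto[where R = R] convex_zonoid zonoid_nonempty
        support_function_zonoid_tendsto M \<mu> conv)
qed

text \<open>A nonzero volume makes the box nonempty; for an empty box the product of the coordinates
  could be nonzero.\<close>

lemma volume_parallelotope:
  fixes \<mu> :: "(real ^ 'n) measure"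
  assumes "volume (parallelotope \<mu>) \<noteq> 0"
  shows "volume (parallelotope \<mu>) = (\<Prod>i\<in>UNIV. mean \<mu> $ i)"
proof -
  have eq: "parallelotope \<mu> = cbox 0 (mean \<mu>)"
    by (auto simp: parallelotope_def simp flip: interval_cbox_cart)
  show ?thesis using assms unfolding eq by (simp add: content_cbox_if_cart split: if_splits)
qed

theorem theorem4p12:
  fixes m :: nat
    and M :: "nat \<Rightarrow> (real ^ 'n) measure"
    and \<mu> :: "(real ^ 'n) measure"
  assumes "m \<ge> 1" and "CARD('n) = m + 1"
    and "\<And>k. M k \<in> P1plus" and "\<mu> \<in> P1plus"
    and "volume (parallelotope \<mu>) \<noteq> 0"
    and "\<And>k. volume (parallelotope (M k)) \<noteq> 0"
    and "converges_in_mean M \<mu>"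
  shows "(\<lambda>k. gini_index (M k)) \<longlonglongrightarrow> gini_index \<mu>"
proof -
  have "(\<lambda>k. volume (parallelotope (M k))) \<longlonglongrightarrow> volume (parallelotope \<mu>)"
    using assms(7) unfolding volume_parallelotope[OF assms(5)] volume_parallelotope[OF assms(6)]
      converges_in_mean_def
    by (intro tendsto_prod tendsto_vec_nth) auto
  then show ?thesis
    unfolding gini_index_def
    by (intro tendsto_divide volume_zonoid_tendsto assms)
qed

end
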